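(* Let $n\ge 2$ be an integer and let $r=\lfloor n/2\rfloor-1$. Then there exists an $(r,\le 2)$-identifying code in $\mathbb{F}^n$ of size at most $n^3-n^2$.
   Context: Let $\mathbb{F}=\{0,1\}$ and let $\mathbb{F}^n$ be the binary Hamming space (hypercube), with Hamming distance $d(x,y)$ = number of coordinates in which $x$ and $y$ differ. For $x\in\mathbb{F}^n$ put $B_r(x)=\{y\in\mathbb{F}^n: d(x,y)\le r\}$, and for $X\subseteq\mathbb{F}^n$ put $B_r(X)=\bigcup_{x\in X}B_r(x)$. A code is a nonempty subset $C\subseteq\mathbb{F}^n$; write $I_r(C;X)=B_r(X)\cap C$ (so $I_r(C;\emptyset)=\emptyset$). For non-negative integers $r,\ell$, a code $C\subseteq\mathbb{F}^n$ is $(r,\le\ell)$-identifying if $I_r(C;X)\ne I_r(C;Y)$ for all $X,Y\subseteq\mathbb{F}^n$ with $|X|\le\ell$, $|Y|\le\ell$ and $X\neq Y$ (the empty set is allowed as $X$ or $Y$). *)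

theory Defs
  imports Main
begin

text \<open>Words over \<open>\<bbbF> = {0, 1}\<close> are Boolean lists, with False for 0 and True for 1.\<close>

definition hypercube :: "nat \<Rightarrow> bool list set" where
  "hypercube n = {x. length x = n}"

text \<open>Only meaningful for words of equal length.\<close>

definition hamming_dist :: "bool list \<Rightarrow> bool list \<Rightarrow> nat" where
  "hamming_dist x y = card {i. i < length x \<and> x ! i \<noteq> y ! i}"

definition hamming_ball :: "nat \<Rightarrow> nat \<Rightarrow> bool list \<Rightarrow> bool list set" where
  "hamming_ball n r x = {y \<in> hypercube n. hamming_dist x y \<le> r}"

definition hamming_nbhd :: "nat \<Rightarrow> nat \<Rightarrow> bool list set \<Rightarrow> bool list set" where
  "hamming_nbhd n r X = (\<Union>x\<in>X. hamming_ball n r x)"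

definition is_code :: "nat \<Rightarrow> bool list set \<Rightarrow> bool" where
  "is_code n C \<longleftrightarrow> C \<subseteq> hypercube n \<and> C \<noteq> {}"

definition I_set :: "nat \<Rightarrow> nat \<Rightarrow> bool list set \<Rightarrow> bool list set \<Rightarrow> bool list set" where
  "I_set n r C X = hamming_nbhd n r X \<inter> C"

text \<open>\<open>identifying_code n r l C\<close>: \<open>C\<close> is an \<open>(r, \<le> l)\<close>-identifying code in \<open>\<bbbF>\<^sup>n\<close>.\<close>

definition identifying_code :: "nat \<Rightarrow> nat \<Rightarrow> nat \<Rightarrow> bool list set \<Rightarrow> bool" where
  "identifying_code n r l C \<longleftrightarrow>
     is_code n C \<and>
     (\<forall>X Y. X \<subseteq> hypercube n \<and> Y \<subseteq> hypercube n \<and> card X \<le> l \<and> card Y \<le> l \<and> X \<noteq> Y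
        \<longrightarrow> I_set n r C X \<noteq> I_set n r C Y)"

end

theory Submission
  imports Defs "HOL-Analysis.Harmonic_Numbers"
begin

text \<open>It suffices that for every word \<open>x\<close> and all words \<open>y\<close>, \<open>z\<close> different from \<open>x\<close> some codeword
  lies within distance \<open>r\<close> of \<open>x\<close> but of neither \<open>y\<close> nor \<open>z\<close>. Because \<open>r\<close> is just below \<open>n/2\<close>, at
  least a fraction \<open>1 / (4 (n + 1))\<close> of all words does this for a given triple: choose a word that is
  balanced both where \<open>y\<close> and \<open>z\<close> agree and where they differ, hence at distance about \<open>n/2\<close> from
  both; complementing suitable coordinates keeps it so, and moves it close to \<open>x\<close> if it was far. Since
  there are at most \<open>2\<^sup>3\<^sup>n\<^sup>-\<^sup>1\<close> triples, a greedy choice of \<open>n\<^sup>3 - n\<^sup>2\<close> words serves all of them when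
  \<open>n \<ge> 10\<close>; for \<open>n \<le> 9\<close> the whole space is small enough.\<close>

section \<open>Estimates for central binomial coefficients\<close>

definition central :: "nat \<Rightarrow> nat" where
  "central k = k choose (k div 2)"

lemma choose_half_up: "k choose ((k + 1) div 2) = central k"
proof -
  have "k - (k + 1) div 2 = k div 2" by linarith
  then show ?thesis
    using binomial_symmetric[of "(k + 1) div 2" k] by (simp add: central_def)
qed

text \<open>Pascal's rule: both summands are middle entries of the odd row, hence equal.\<close>

lemma central_Suc_odd: "central (2 * m + 2) = 2 * central (2 * m + 1)"
proof -
  have "central (2 * m + 2) = Suc (2 * m + 1) choose Suc m" by (simp add: central_def)
  also have "\<dots> = (2 * m + 1 choose m) + (2 * m + 1 choose Suc m)" by (rule binomial_Suc_Suc)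
  also have "(2 * m + 1 choose Suc m) = central (2 * m + 1)"
    using choose_half_up[of "2 * m + 1"] by simp
  also have "(2 * m + 1 choose m) = central (2 * m + 1)" by (simp add: central_def)
  finally show ?thesis by simp
qed

lemma central_Suc_even: "(m + 1) * central (2 * m + 1) = (2 * m + 1) * central (2 * m)"
proof -
  have "central (2 * m + 1) = Suc (2 * m) choose Suc m"
    using choose_half_up[of "2 * m + 1"] by simp
  then show ?thesis
    using Suc_times_binomial[of m "2 * m"] by (simp add: central_def)
qed

text \<open>The classical bound \<open>4 ^ m / (2 * sqrt m)\<close> for
  \<open>central (2 * m)\<close>, squared to stay in the natural numbers. Passing to
  \<open>m + 1\<close> multiplies the coefficient by \<open>2 * (2 * m + 1) / (m + 1)\<close>, and
  the induction closes because \<open>4 * m * (m + 1) \<le> (2 * m + 1)^2\<close>.\<close>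

lemma central_even_lower: "m > 0 \<Longrightarrow> 16 ^ m \<le> 4 * m * (central (2 * m))\<^sup>2"
proof (induction m rule: nat_induct_non_zero)
  case 1
  show ?case by (simp add: central_def)
next
  case (Suc m)
  have rec: "(m + 1) * central (2 * Suc m) = 2 * ((2 * m + 1) * central (2 * m))"
    using central_Suc_even[of m] central_Suc_odd[of m] by simp
  have "(m + 1) * 16 ^ Suc m = (m + 1) * 16 * 16 ^ m" by (simp add: algebra_simps)
  also have "\<dots> \<le> (m + 1) * 16 * (4 * m * (central (2 * m))\<^sup>2)"
    by (rule mult_left_mono[OF Suc.IH]) simp
  also have "\<dots> = 16 * (4 * m * (m + 1)) * (central (2 * m))\<^sup>2"
    by (simp add: algebra_simps)
  also have "\<dots> \<le> 16 * (2 * m + 1)\<^sup>2 * (central (2 * m))\<^sup>2"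
    by (intro mult_right_mono mult_left_mono) (simp_all add: power2_eq_square algebra_simps)
  also have "\<dots> = 4 * (2 * ((2 * m + 1) * central (2 * m)))\<^sup>2"
    by (simp only: power_mult_distrib) simp
  also have "\<dots> = 4 * ((m + 1) * central (2 * Suc m))\<^sup>2"
    by (simp only: rec)
  also have "\<dots> = (m + 1) * (4 * Suc m * (central (2 * Suc m))\<^sup>2)"
    by (simp add: power2_eq_square algebra_simps)
  finally have "(m + 1) * 16 ^ Suc m \<le> (m + 1) * (4 * Suc m * (central (2 * Suc m))\<^sup>2)" .
  then show ?case by (metis mult_le_cancel1 add_gr_0 zero_less_one)
qed

text \<open>One form for both parities: for odd \<open>k\<close> the even bound is applied to
  \<open>k + 1\<close>, whose central coefficient is twice that of \<open>k\<close>.\<close>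

lemma central_lower: "4 ^ k \<le> 2 * (k + 1) * (central k)\<^sup>2"
proof (cases "even k")
  case True
  then obtain m where k: "k = 2 * m" by blast
  show ?thesis
  proof (cases "m = 0")
    case True
    then show ?thesis by (simp add: k central_def)
  next
    case False
    then have "16 ^ m \<le> 4 * m * (central k)\<^sup>2" using central_even_lower[of m] k by simp
    also have "\<dots> \<le> 2 * (k + 1) * (central k)\<^sup>2" by (simp add: k)
    finally show ?thesis by (simp add: k power_mult)
  qed
next
  case False
  then obtain m where k: "k = 2 * m + 1" using oddE by blast
  have "16 ^ (m + 1) \<le> 4 * (m + 1) * (central (2 * (m + 1)))\<^sup>2"
    by (rule central_even_lower) simp
  also have "central (2 * (m + 1)) = 2 * central k" using central_Suc_odd[of m] k by simp
  also have "4 * (m + 1) * (2 * central k)\<^sup>2 = 4 * (2 * (k + 1) * (central k)\<^sup>2)"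
    by (simp add: k power_mult_distrib algebra_simps)
  also have "(16::nat) ^ (m + 1) = 4 * 4 ^ k" by (simp add: k power_mult)
  finally show ?thesis by simp
qed

text \<open>The inequality of arithmetic and geometric means, applied to \<open>k + 1\<close> and
  \<open>l + 1\<close>, makes the bound depend on \<open>k + l\<close> only. So it does not matter
  how the coordinates are split into two blocks.\<close>

lemma central_mult_lower: "2 ^ (k + l) \<le> (k + l + 2) * (central k * central l)"
proof -
  have "(2 ^ (k + l))\<^sup>2 = (4 ^ k * 4 ^ l :: nat)"
    by (metis power2_eq_square power_add mult_2 numeral_Bit0 power_mult)
  also have "\<dots> \<le> (2 * (k + 1) * (central k)\<^sup>2) * (2 * (l + 1) * (central l)\<^sup>2)"
    by (intro mult_mono central_lower) simp_all
  also have "\<dots> = (4 * ((k + 1) * (l + 1))) * (central k * central l)\<^sup>2"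
    by (simp add: power_mult_distrib algebra_simps)
  also have "\<dots> \<le> (k + l + 2)\<^sup>2 * (central k * central l)\<^sup>2"
  proof (rule mult_right_mono)
    have "int (4 * ((k + 1) * (l + 1))) \<le> int ((k + l + 2)\<^sup>2)"
      using zero_le_power2[of "int k - int l"] by (simp add: power2_eq_square algebra_simps)
    then show "4 * ((k + 1) * (l + 1)) \<le> (k + l + 2)\<^sup>2" by linarith
  qed simp
  also have "\<dots> = ((k + l + 2) * (central k * central l))\<^sup>2"
    by (simp only: power_mult_distrib)
  finally show ?thesis by (rule power2_le_imp_le) simp
qed

text \<open>The neighbour of the middle coefficient is \<open>m / (m + 1)\<close> times as large,
  which is at least one half.\<close>

lemma choose_below_central: "m > 0 \<Longrightarrow> central (2 * m) \<le> 2 * (2 * m choose (m - 1))"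
proof -
  assume "m > 0"
  then obtain t where m: "m = Suc t" by (cases m) auto
  have "Suc t * (2 * m choose Suc t) = (2 * m - t) * (2 * m choose t)"
    by (metis binomial_absorb_comp binomial_absorption)
  then have "Suc t * central (2 * m) = Suc (Suc t) * (2 * m choose t)"
    by (simp add: central_def m)
  also have "\<dots> \<le> Suc t * (2 * (2 * m choose t))" by simp
  finally show ?thesis by (simp only: Suc_mult_le_cancel1) (simp add: m)
qed

text \<open>Two terms of Vandermonde's convolution suffice, or three when \<open>a\<close> is even.\<close>

lemma central_add_aux:
  assumes "a > 0" "b > 0" "even b"
  shows "3 * (central a * central b) \<le> 2 * central (a + b)"
proof -
  obtain s where b: "b = 2 * s" using assms(3) by blast
  have s: "s > 0" using assms(2) b by simp
  define h where "h = a div 2 + s"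
  define t where "t k = (a choose k) * (b choose (h - k))" for k
  have vm: "central (a + b) = (\<Sum>k\<le>h. t k)"
    using vandermonde[of a b h] by (simp add: t_def central_def b h_def add.commute)
  \<comment> \<open>A side term loses at most a factor 2 from \<open>b\<close>, and another from
    \<open>a\<close> when \<open>a\<close> is even. The terms thus amount to at least 1 + 1/2 or 1 +
    1/4 + 1/4 times the middle one.\<close>
  have nb: "central b \<le> 2 * (b choose (s - 1))"
    using choose_below_central[OF s] b by simp
  have mid: "t (a div 2) = central a * central b"
    by (simp add: t_def h_def central_def b)
  have up: "t (a div 2 + 1) = (a choose (a div 2 + 1)) * (b choose (s - 1))"
    by (simp add: t_def h_def)
  show ?thesis
  proof (cases "even a")
    case False
    then have ac: "a choose (a div 2 + 1) = central a"
      using choose_half_up[of a] by (simp add: Suc_div_eq_add3_div)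
    have "t (a div 2) + t (a div 2 + 1) = sum t {a div 2, a div 2 + 1}" by simp
    also have "\<dots> \<le> (\<Sum>k\<le>h. t k)"
      using s by (intro sum_mono2) (auto simp: h_def)
    finally have "central a * central b + central a * (b choose (s - 1)) \<le> central (a + b)"
      using mid up ac vm by simp
    moreover have "central a * central b \<le> 2 * (central a * (b choose (s - 1)))"
      using nb by simp
    ultimately show ?thesis by linarith
  next
    case True
    then obtain r where a: "a = 2 * r" by blast
    have r: "r > 0" using assms(1) a by simp
    have na: "central a \<le> 2 * (a choose (r - 1))"
      using choose_below_central[OF r] a by simp
    have ra: "a choose (r + 1) = a choose (r - 1)"
      using binomial_symmetric[of "r - 1" a] r a by simp
    have rb: "b choose (s + 1) = b choose (s - 1)"
      using binomial_symmetric[of "s - 1" b] s b by simp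
    have dn: "t (r - 1) = (a choose (r - 1)) * (b choose (s - 1))"
      using r a rb by (simp add: t_def h_def)
    have "t (r - 1) + t r + t (r + 1) = sum t {r - 1, r, r + 1}" using r by (cases r) auto
    also have "\<dots> \<le> (\<Sum>k\<le>h. t k)"
      using s a r by (intro sum_mono2) (auto simp: h_def)
    finally have "central a * central b + 2 * ((a choose (r - 1)) * (b choose (s - 1)))
        \<le> central (a + b)"
      using mid up dn ra vm a by simp
    moreover have "central a * central b \<le> (2 * (a choose (r - 1))) * (2 * (b choose (s - 1)))"
      using na nb by (intro mult_mono) simp_all
    ultimately show ?thesis by linarith
  qed
qed

text \<open>The factor 2/3 serves to bound the share of balanced sets that remain balanced after
  symmetric difference with \<open>T\<close>.\<close>

lemma central_add:
  assumes "a > 0" "b > 0" "even a \<or> even b"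
  shows "3 * (central a * central b) \<le> 2 * central (a + b)"
  using assms central_add_aux[of a b] central_add_aux[of b a]
  by (auto simp: ac_simps)

section \<open>Balanced sets and separating sets\<close>

text \<open>Half of \<open>A\<close> up to rounding, without division: one size if
  \<open>card A\<close> is even, both middle sizes if it is odd. For finite \<open>A\<close> this
  makes the family closed under complement in \<open>A\<close>.\<close>

definition balanced :: "'a set \<Rightarrow> 'a set set" where
  "balanced A = {E. E \<subseteq> A \<and> card A \<le> 2 * card E + 1 \<and> 2 * card E \<le> card A + 1}"

text \<open>Words are taken relative to \<open>z\<close>: a codeword \<open>c\<close> is the set \<open>D\<close> of coordinates where it differs
  from \<open>z\<close>, while \<open>T\<close> and \<open>U\<close> are the sets where \<open>x\<close> and \<open>y\<close> differ from \<open>z\<close>. Note that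
  \<open>d \<le> r\<close> means \<open>d < n div 2\<close>.\<close>

definition separating :: "'a set \<Rightarrow> 'a set \<Rightarrow> 'a set \<Rightarrow> 'a set set" where
  "separating N T U = {D. D \<subseteq> N \<and> card (sym_diff D T) < card N div 2 \<and>
     card N div 2 \<le> card (sym_diff D U) \<and> card N div 2 \<le> card D}"

lemma finite_balanced [simp]: "finite A \<Longrightarrow> finite (balanced A)"
  by (rule finite_subset[of _ "Pow A"]) (auto simp: balanced_def)

lemma finite_separating [simp]: "finite N \<Longrightarrow> finite (separating N T U)"
  by (rule finite_subset[of _ "Pow N"]) (auto simp: separating_def)

lemma card_balanced:
  assumes "finite A"
  shows "card (balanced A) =
    (if even (card A) then central (card A) else 2 * central (card A))"
proof (cases "even (card A)")
  case True
  then obtain m where m: "card A = 2 * m" by blast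
  have "balanced A = {E. E \<subseteq> A \<and> card E = m}"
    unfolding balanced_def m by auto
  then show ?thesis
    using n_subsets[OF assms, of m] m by (simp add: central_def)
next
  case False
  then obtain m where m: "card A = 2 * m + 1" using oddE by blast
  have "balanced A = {E. E \<subseteq> A \<and> card E = m} \<union> {E. E \<subseteq> A \<and> card E = m + 1}"
    unfolding balanced_def m by auto
  also have "card \<dots> = card {E. E \<subseteq> A \<and> card E = m} + card {E. E \<subseteq> A \<and> card E = m + 1}"
    using assms by (intro card_Un_disjoint) auto
  also have "\<dots> = 2 * central (card A)"
    using n_subsets[OF assms, of m] n_subsets[OF assms, of "m + 1"] m
      choose_half_up[of "card A"] by (simp add: central_def)
  finally show ?thesis using False by simp
qed

section \<open>Lower bounds for the number of separating sets\<close>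

text \<open>\<open>E\<close> and \<open>G\<close> are recovered from their union as its traces on
  the disjoint sets \<open>A\<close> and \<open>B\<close>.\<close>

lemma card_join:
  assumes "A \<inter> B = {}" "\<A> \<subseteq> Pow A" "\<B> \<subseteq> Pow B"
  shows "card ((\<lambda>(E, G). E \<union> G) ` (\<A> \<times> \<B>)) = card \<A> * card \<B>"
proof -
  have "inj_on (\<lambda>(E, G). E \<union> G) (\<A> \<times> \<B>)"
  proof (rule inj_onI, clarify)
    fix E G E' G'
    assume mem: "E \<in> \<A>" "G \<in> \<B>" "E' \<in> \<A>" "G' \<in> \<B>" and eq: "E \<union> G = E' \<union> G'"
    then have "E = (E \<union> G) \<inter> A" "E' = (E' \<union> G') \<inter> A" "G = (E \<union> G) \<inter> B" "G' = (E' \<union> G') \<inter> B"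
      using assms by blast+
    then show "E = E' \<and> G = G'" using eq by simp
  qed
  then show ?thesis by (simp add: card_image card_cartesian_product)
qed

text \<open>In the applications \<open>f\<close> is complementation and \<open>L\<close> collects
  the sets near \<open>T\<close>; outside the exceptional family \<open>M\<close>, a set or its
  complement is near.\<close>

lemma card_le_twice_involution:
  assumes "finite M" "finite L" "X \<subseteq> M \<union> L \<union> f ` L"
  shows "card X \<le> card M + 2 * card L"
proof -
  have "card X \<le> card (M \<union> L \<union> f ` L)" using assms by (intro card_mono) auto
  also have "\<dots> \<le> card (M \<union> L) + card (f ` L)" by (rule card_Un_le)
  also have "\<dots> \<le> (card M + card L) + card L"
    by (intro add_mono card_Un_le card_image_le assms)
  finally show ?thesis by simp
qed

text \<open>Serves as a parity statement: a symmetric difference has the parity of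
  \<open>card A + card B\<close>.\<close>

lemma card_sym_diff_parity:
  assumes "finite A" "finite B"
  shows "card (sym_diff A B) + 2 * card (A \<inter> B) = card A + card B"
proof -
  have "card (sym_diff A B) = card (A - B) + card (B - A)"
    using assms by (intro card_Un_disjoint) auto
  moreover have "card A = card (A - B) + card (A \<inter> B)"
    using assms by (metis card_Diff_subset_Int card_mono finite_Int inf_le1 le_add_diff_inverse2)
  moreover have "card B = card (B - A) + card (A \<inter> B)"
    using assms by (metis card_Diff_subset_Int card_mono finite_Int inf_le1 inf_commute
      le_add_diff_inverse2)
  ultimately show ?thesis by simp
qed

text \<open>Complementing a balanced set of coordinates outside \<open>I\<close> preserves the distance constraints
  to the centre and to \<open>U\<close>, and one of the two choices is close to \<open>T\<close>, because an odd number of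
  coordinates remains.\<close>

lemma separating_lower_outside:
  assumes N: "finite N" and sub: "T \<subseteq> N" "U \<subseteq> N" "I \<subseteq> N"
    and i: "i \<in> I" "i \<in> T" "i \<notin> U"
    and cardI: "card (N - I) + 1 = 2 * (card N div 2)"
  shows "central (card (U - I)) * central (card (N - I - U)) \<le> card (separating N T U)"
proof -
  define m where "m = card N div 2"
  \<comment> \<open>Outside \<open>I\<close>, \<open>A\<close> holds the coordinates where y and z
    differ and \<open>B\<close> those where they agree.\<close>
  define A where "A = U - I"
  define B where "B = N - I - U"
  define X where "X = (\<lambda>(E, G). E \<union> G) ` (balanced A \<times> balanced B)"
  define L where "L = {H \<in> X. card (sym_diff H (T - I)) < m}"
  have fin [simp]: "finite A" "finite B" "finite I" "finite U" "finite T"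
    using N sub by (auto simp: A_def B_def intro: finite_subset)
  have AB: "A \<inter> B = {}" "A \<union> B = N - I" using sub by (auto simp: A_def B_def)
  have cAB: "card A + card B + 1 = 2 * m"
    using cardI card_Un_disjoint[of A B] AB by (simp add: m_def)
  \<comment> \<open>Exactly one of \<open>A\<close> and \<open>B\<close> has odd size and so
    contributes two middle sizes. This factor 2 pays for keeping only one set of each complementary
    pair.\<close>
  have cX: "card X = 2 * (central (card A) * central (card B))"
  proof -
    have "card X = card (balanced A) * card (balanced B)"
      unfolding X_def using AB by (intro card_join[of A B]) (auto simp: balanced_def)
    moreover have "even (card A) \<longleftrightarrow> odd (card B)" using cAB by presburger
    ultimately show ?thesis by (auto simp: card_balanced)
  qed
  have finX: "finite X" by (simp add: X_def)
  \<comment> \<open>The sizes of \<open>A\<close> and \<open>B\<close> add up to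
    \<open>2 * m - 1\<close>, so \<open>H\<close> and its symmetric difference with \<open>A\<close>
    have \<open>m - 1\<close> or \<open>m\<close> elements. The one that may be missing is supplied
    later by \<open>i\<close>.\<close>
  have sizes: "H \<subseteq> N - I \<and> m \<le> card H + 1 \<and> m \<le> card (sym_diff H A) + 1 \<and> N - I - H \<in> X"
    if "H \<in> X" for H
  proof -
    from that obtain E G where EG: "E \<in> balanced A" "G \<in> balanced B" and H: "H = E \<union> G"
      by (auto simp: X_def)
    have s: "E \<subseteq> A" "G \<subseteq> B" using EG by (auto simp: balanced_def)
    have f: "finite E" "finite G" using s by (auto intro: finite_subset[OF _ fin(1)] finite_subset[OF _ fin(2)])
    have cE: "card (A - E) = card A - card E" "card E \<le> card A"
      using s f by (auto simp: card_Diff_subset intro: card_mono)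
    have cG: "card (B - G) = card B - card G" "card G \<le> card B"
      using s f by (auto simp: card_Diff_subset intro: card_mono)
    have 1: "card H = card E + card G"
      unfolding H using AB s f by (intro card_Un_disjoint) auto
    have "sym_diff H A = (A - E) \<union> G" unfolding H using AB s by auto
    then have 2: "card (sym_diff H A) = card A - card E + card G"
      using AB s f cE by (metis card_Un_disjoint finite_Diff fin(1) Diff_subset disjoint_iff subsetD)
    have "N - I - H = (A - E) \<union> (B - G)" unfolding H using AB s by auto
    moreover have "A - E \<in> balanced A" "B - G \<in> balanced B"
      using EG cE cG by (auto simp: balanced_def)
    ultimately have 3: "N - I - H \<in> X" unfolding X_def by auto
    have bE: "card A \<le> 2 * card E + 1" "2 * card E \<le> card A + 1"
      and bG: "card B \<le> 2 * card G + 1" "2 * card G \<le> card B + 1"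
      using EG by (auto simp: balanced_def)
    have "m \<le> card E + card G + 1"
      using bE(1) bG(1) cAB by linarith
    moreover have "m \<le> (card A - card E) + card G + 1"
      using bE bG cAB cE(2) by linarith
    moreover have "H \<subseteq> N - I" unfolding H using s AB by auto
    ultimately show ?thesis using 1 2 3 by simp
  qed
  have "X \<subseteq> {} \<union> L \<union> (\<lambda>H. N - I - H) ` L"
  proof
    fix H assume H: "H \<in> X"
    note sz = sizes[OF H]
    have cc: "N - I - (N - I - H) = H" using sz by auto
    have "sym_diff (N - I - H) (T - I) = (N - I) - sym_diff H (T - I)"
      using sz sub by auto
    moreover have "sym_diff H (T - I) \<subseteq> N - I" using sz sub by auto
    ultimately have "card (sym_diff (N - I - H) (T - I)) = card (N - I) - card (sym_diff H (T - I))"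
      using N by (metis card_Diff_subset finite_Diff finite_subset)
    \<comment> \<open>The two distances add up to \<open>2 * m - 1\<close>, so they cannot both
      reach \<open>m\<close>.\<close>
    then have "card (sym_diff H (T - I)) < m \<or> card (sym_diff (N - I - H) (T - I)) < m"
      using cardI unfolding m_def by linarith
    then show "H \<in> {} \<union> L \<union> (\<lambda>H. N - I - H) ` L"
    proof
      assume "card (sym_diff (N - I - H) (T - I)) < m"
      then have "N - I - H \<in> L" using sz by (simp add: L_def)
      then show ?thesis using cc by (metis UnCI image_eqI)
    qed (use H in \<open>simp add: L_def\<close>)
  qed
  then have "card X \<le> 2 * card L"
    using card_le_twice_involution[of "{}" L X] finX by (simp add: L_def)
  then have "central (card A) * central (card B) \<le> card L" using cX by simp
  also have "card L = card ((\<lambda>H. H \<union> (T \<inter> I)) ` L)"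
  proof (rule card_image[symmetric], rule inj_onI)
    fix H H' assume "H \<in> L" "H' \<in> L" and eq: "H \<union> T \<inter> I = H' \<union> T \<inter> I"
    then have "H \<subseteq> N - I" "H' \<subseteq> N - I" using sizes by (auto simp: L_def)
    then show "H = H'" using eq by blast
  qed
  also have "\<dots> \<le> card (separating N T U)"
  proof (rule card_mono)
    show "(\<lambda>H. H \<union> (T \<inter> I)) ` L \<subseteq> separating N T U"
    proof clarify
      fix H assume "H \<in> L"
      then have HX: "H \<in> X" and lt: "card (sym_diff H (T - I)) < m" by (auto simp: L_def)
      note sz = sizes[OF HX]
      \<comment> \<open>On \<open>I\<close> the set agrees with \<open>T\<close>, so the distance to
        \<open>T\<close> does not grow; as \<open>i\<close> lies in \<open>T\<close> but not in
        \<open>U\<close>, it adds one to the distances from the empty set and from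
        \<open>U\<close>.\<close>
      let ?D = "H \<union> (T \<inter> I)"
      have finH: "finite H" using sz N finite_subset by blast
      have "sym_diff ?D T = sym_diff H (T - I)" using sz by auto
      moreover have "m \<le> card ?D"
      proof -
        have "card (insert i H) \<le> card ?D" using i finH by (intro card_mono) auto
        moreover have "i \<notin> H" using sz i by auto
        ultimately show ?thesis using sz finH by simp
      qed
      moreover have "m \<le> card (sym_diff ?D U)"
      proof -
        have "insert i (sym_diff H A) \<subseteq> sym_diff ?D U"
          using i sz by (auto simp: A_def)
        then have "card (insert i (sym_diff H A)) \<le> card (sym_diff ?D U)"
          using finH by (intro card_mono) auto
        moreover have "i \<notin> sym_diff H A" using sz i by (auto simp: A_def)
        ultimately show ?thesis using sz finH by simp
      qed
      moreover have "?D \<subseteq> N" using sz sub by auto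
      ultimately show "?D \<in> separating N T U" using lt by (simp add: separating_def m_def)
    qed
  qed (simp add: N)
  finally show ?thesis by (simp add: A_def B_def)
qed

text \<open>Here a set \<open>D\<close> is split into \<open>E = D \<inter> U\<close> and \<open>G = D - U\<close>. Its distances to the empty set
  and to \<open>U\<close> depend only on the two cardinalities.\<close>

lemma separating_lower_product:
  assumes N: "finite N" and sub: "T \<subseteq> U" "U \<subseteq> N"
    and LG: "\<And>E G. E \<in> L \<Longrightarrow> G \<in> \<G> \<Longrightarrow> E \<subseteq> U \<and> G \<subseteq> N - U \<and>
      card (sym_diff E T) + card G < card N div 2 \<and>
      card N div 2 \<le> card U - card E + card G \<and>
      card N div 2 \<le> card E + card G"
    and ne: "L \<subseteq> Pow U" "\<G> \<subseteq> Pow (N - U)"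
  shows "card L * card \<G> \<le> card (separating N T U)"
proof -
  have "card L * card \<G> = card ((\<lambda>(E, G). E \<union> G) ` (L \<times> \<G>))"
    using ne by (intro card_join[of U "N - U", symmetric]) auto
  also have "\<dots> \<le> card (separating N T U)"
  proof (rule card_mono)
    show "(\<lambda>(E, G). E \<union> G) ` (L \<times> \<G>) \<subseteq> separating N T U"
    proof clarify
      fix E G assume EG: "E \<in> L" "G \<in> \<G>"
      note h = LG[OF EG]
      have f: "finite U" "finite E" "finite G" "finite T"
        using h N sub by (meson finite_Diff finite_subset)+
      have "card (E \<union> G) = card E + card G"
        using h f by (intro card_Un_disjoint) auto
      moreover have "card (sym_diff (E \<union> G) U) = card U - card E + card G"
      proof -
        have "sym_diff (E \<union> G) U = (U - E) \<union> G" using h by auto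
        moreover have "card ((U - E) \<union> G) = card (U - E) + card G"
          using h f by (intro card_Un_disjoint) auto
        ultimately show ?thesis using h f by (simp add: card_Diff_subset)
      qed
      moreover have "card (sym_diff (E \<union> G) T) = card (sym_diff E T) + card G"
      proof -
        have "sym_diff (E \<union> G) T = sym_diff E T \<union> G" using h sub by auto
        moreover have "card (sym_diff E T \<union> G) = card (sym_diff E T) + card G"
          using h f sub by (intro card_Un_disjoint) auto
        ultimately show ?thesis by simp
      qed
      ultimately show "E \<union> G \<in> separating N T U"
        using h sub by (auto simp: separating_def)
    qed
  qed (simp add: N)
  finally show ?thesis .
qed

text \<open>With \<open>p = card (E - T)\<close> and \<open>q = card (E \<inter> T)\<close>, the two
  sizes are \<open>p + q\<close> and \<open>p + card T - q\<close>. Adding and subtracting the two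
  balance conditions shows that \<open>E - T\<close> and \<open>E \<inter> T\<close> are balanced in
  \<open>U - T\<close> and \<open>T\<close>.\<close>

lemma card_doubly_balanced:
  assumes U: "finite U" and T: "T \<subseteq> U"
  shows "card {E \<in> balanced U. sym_diff E T \<in> balanced U}
    \<le> card (balanced (U - T)) * card (balanced T)"
proof -
  have fT: "finite T" using U T finite_subset by blast
  have cU: "card U = card (U - T) + card T"
    using U T by (metis card_Diff_subset card_mono fT le_add_diff_inverse2)
  have "{E \<in> balanced U. sym_diff E T \<in> balanced U}
    \<subseteq> (\<lambda>(E, G). E \<union> G) ` (balanced (U - T) \<times> balanced T)"
  proof clarify
    fix E assume E: "E \<in> balanced U" and ET: "sym_diff E T \<in> balanced U"
    have s: "E \<subseteq> U" using E by (auto simp: balanced_def)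
    have f: "finite E" using s U finite_subset by blast
    have 1: "card E = card (E - T) + card (E \<inter> T)"
      using f by (metis card_Diff_subset_Int card_mono finite_Int inf_le1 le_add_diff_inverse2)
    have 2: "card (sym_diff E T) = card (E - T) + card (T - E)"
      using f fT by (intro card_Un_disjoint) auto
    have 3: "card T = card (T - E) + card (E \<inter> T)"
      using fT by (metis card_Diff_subset_Int card_mono finite_Int inf_le1 inf_commute
        le_add_diff_inverse2)
    have "E - T \<in> balanced (U - T)" "E \<inter> T \<in> balanced T"
      using E ET s 1 2 3 cU unfolding balanced_def by auto
    moreover have "E = (E - T) \<union> (E \<inter> T)" by auto
    ultimately show "E \<in> (\<lambda>(E, G). E \<union> G) ` (balanced (U - T) \<times> balanced T)"
      by (metis (no_types, lifting) SigmaI case_prod_conv image_eqI)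
  qed
  then have "card {E \<in> balanced U. sym_diff E T \<in> balanced U}
    \<le> card ((\<lambda>(E, G). E \<union> G) ` (balanced (U - T) \<times> balanced T))"
    using U fT by (intro card_mono) auto
  also have "\<dots> = card (balanced (U - T)) * card (balanced T)"
    by (rule card_join[of "U - T" T]) (auto simp: balanced_def)
  finally show ?thesis .
qed

text \<open>Complementing within \<open>U\<close> brings a balanced \<open>E\<close> near
  \<open>T\<close> unless its symmetric difference with \<open>T\<close> is balanced too. That
  exception covers at most two thirds of the balanced sets, so at least one sixth of them are near.
  The sizes allowed for the part outside \<open>U\<close> depend on the parities of \<open>k\<close>
  and \<open>b\<close>.\<close>

lemma separating_lower_inside:
  assumes N: "finite N" and sub: "T \<subset> U" "U \<subseteq> N" and T0: "T \<noteq> {}"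
  shows "2 ^ card N \<le> 3 * (card N + 2) * card (separating N T U)"
proof -
  have fin: "finite U" "finite T" using N sub by (meson finite_subset psubset_imp_subset)+
  define k where "k = card U"
  define a where "a = card (U - T)"
  define b where "b = card T"
  define f where "f = card (N - U)"
  define L where "L = {E \<in> balanced U. 2 * card (sym_diff E T) + 1 < k}"
  define M where "M = {E \<in> balanced U. sym_diff E T \<in> balanced U}"
  have k: "k = a + b" unfolding k_def a_def b_def
    using sub fin by (metis card_Diff_subset card_mono le_add_diff_inverse2 psubset_imp_subset)
  have n: "card N = k + f" unfolding k_def f_def
    using sub N by (metis card_Diff_subset card_mono fin(1) le_add_diff_inverse)
  have ab: "a > 0" "b > 0"
    using sub T0 fin by (auto simp: a_def b_def card_gt_0_iff)
  \<comment> \<open>The size of the symmetric difference with \<open>T\<close> lies within, below or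
    above the balanced range; in the last case the complement of \<open>E\<close> falls
    below.\<close>
  have "balanced U \<subseteq> M \<union> L \<union> (\<lambda>E. U - E) ` L"
  proof
    fix E assume E: "E \<in> balanced U"
    then have s: "E \<subseteq> U" by (auto simp: balanced_def)
    have fE: "finite E" using s fin finite_subset by blast
    have CE: "U - E \<in> balanced U"
      using E s fE card_mono[OF fin(1) s] by (auto simp: balanced_def card_Diff_subset)
    have sd: "sym_diff (U - E) T = U - sym_diff E T" using s sub by auto
    have sU: "sym_diff E T \<subseteq> U" using s sub by auto
    have "card (sym_diff (U - E) T) = k - card (sym_diff E T)"
      unfolding sd k_def using sU fin fE by (simp add: card_Diff_subset)
    moreover have "card (sym_diff E T) \<le> k"
      unfolding k_def using sU fin by (intro card_mono)
    moreover have "sym_diff E T \<in> balanced U"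
      if "k \<le> 2 * card (sym_diff E T) + 1" "2 * card (sym_diff E T) \<le> k + 1"
      using sU that by (simp add: balanced_def k_def)
    ultimately consider "sym_diff E T \<in> balanced U" | "2 * card (sym_diff E T) + 1 < k"
      | "2 * card (sym_diff (U - E) T) + 1 < k"
      by linarith
    then show "E \<in> M \<union> L \<union> (\<lambda>E. U - E) ` L"
    proof cases
      case 3
      then have "U - E \<in> L" using CE by (simp add: L_def)
      moreover have "E = U - (U - E)" using s by auto
      ultimately show ?thesis by (metis UnCI image_eqI)
    qed (use E in \<open>auto simp: M_def L_def\<close>)
  qed
  then have split: "card (balanced U) \<le> card M + 2 * card L"
    by (rule card_le_twice_involution[rotated 2]) (simp_all add: M_def L_def fin)
  have cM: "card M \<le> card (balanced (U - T)) * card (balanced T)"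
    unfolding M_def using sub fin by (intro card_doubly_balanced) auto
  have LU: "L \<subseteq> Pow U" by (auto simp: L_def balanced_def)
  have parity: "card (sym_diff E T) + 2 * card (E \<inter> T) = card E + b" if "E \<in> balanced U" for E
    unfolding b_def using that fin
    by (intro card_sym_diff_parity) (auto simp: balanced_def intro: finite_subset)
  have subsets: "card {G. G \<subseteq> N - U \<and> card G = j} = f choose j" for j
    unfolding f_def using N by (intro n_subsets) simp
  have bound: "card L * card \<G> \<le> card (separating N T U)"
    if "\<And>E G. E \<in> L \<Longrightarrow> G \<in> \<G> \<Longrightarrow> card (sym_diff E T) + card G < (k + f) div 2 \<and>
      (k + f) div 2 \<le> k - card E + card G \<and> (k + f) div 2 \<le> card E + card G"
      and "\<G> \<subseteq> Pow (N - U)" for \<G>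
    using that LU N sub n by (intro separating_lower_product) (auto simp: k_def)
  have "\<exists>g. 2 ^ card N \<le> 3 * (card N + 2) * (card L * g) \<and>
    card L * g \<le> card (separating N T U)"
  proof (cases "even k")
    case False
    \<comment> \<open>With \<open>k = 2 * h + 1\<close>, one of \<open>E\<close> and
      \<open>U - E\<close> has only \<open>h\<close> elements, while
      \<open>(k + f) div 2 = h + (f + 1) div 2\<close>; hence the rounding up.\<close>
    define \<G> where "\<G> = {G. G \<subseteq> N - U \<and> card G = (f + 1) div 2}"
    have cG: "card \<G> = central f" unfolding \<G>_def subsets by (rule choose_half_up)
    have "even a \<longleftrightarrow> odd b" using False k by presburger
    then have "card M \<le> 2 * (central a * central b)"
      using cM fin by (auto simp: card_balanced a_def b_def)
    moreover have "3 * (central a * central b) \<le> 2 * central k"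
      using central_add[of a b] ab k \<open>even a \<longleftrightarrow> odd b\<close> by blast
    moreover have "card (balanced U) = 2 * central k"
      using False fin by (simp add: card_balanced k_def)
    \<comment> \<open>At most 4/3 of \<open>central k\<close> out of \<open>2 * central k\<close>
      sets are lost to \<open>M\<close>, and half of the rest lies in \<open>L\<close>.\<close>
    ultimately have cL: "central k \<le> 3 * card L" using split by linarith
    have "2 ^ card N \<le> (card N + 2) * (central k * central f)"
      unfolding n by (rule central_mult_lower)
    also have "\<dots> \<le> (card N + 2) * (3 * card L * card \<G>)"
      unfolding cG using cL by (intro mult_left_mono mult_right_mono) auto
    finally have "2 ^ card N \<le> 3 * (card N + 2) * (card L * card \<G>)" by (simp add: algebra_simps)
    moreover have "card L * card \<G> \<le> card (separating N T U)"
    proof (rule bound)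
      fix E G assume "E \<in> L" "G \<in> \<G>"
      then have E: "k \<le> 2 * card E + 1" "2 * card E \<le> k + 1" "2 * card (sym_diff E T) + 1 < k"
        and G: "card G = (f + 1) div 2"
        by (auto simp: L_def \<G>_def balanced_def k_def)
      show "card (sym_diff E T) + card G < (k + f) div 2 \<and>
        (k + f) div 2 \<le> k - card E + card G \<and> (k + f) div 2 \<le> card E + card G"
      proof -
        obtain h where h: "k = 2 * h + 1" using False oddE by blast
        have "card E = h \<or> card E = h + 1" "card (sym_diff E T) < h"
          using E unfolding h by linarith+
        moreover have "(k + f) div 2 = h + (f + 1) div 2" unfolding h by linarith
        ultimately show ?thesis unfolding G h by auto
      qed
    qed (auto simp: \<G>_def)
    ultimately show ?thesis by blast
  next
    case True
    then obtain h where h: "k = 2 * h" by blast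
    have cU: "card (balanced U) = central k"
      using True fin by (simp add: card_balanced k_def)
    have EL: "card E = h" "card (sym_diff E T) < h" if "E \<in> L" for E
      using that h by (auto simp: L_def balanced_def k_def)
    show ?thesis
    proof (cases "even b")
      case False
      \<comment> \<open>Now \<open>E\<close> has exactly \<open>h\<close> elements and
        \<open>(k + f) div 2 = h + f div 2\<close>, so rounding down suffices.\<close>
      define \<G> where "\<G> = {G. G \<subseteq> N - U \<and> card G = f div 2}"
      have cG: "card \<G> = central f" unfolding \<G>_def subsets by (simp add: central_def)
      \<comment> \<open>If \<open>E\<close> and its symmetric difference with \<open>T\<close> both
        had \<open>h\<close> elements, \<open>T\<close> would be split in half by \<open>E\<close>,
        against \<open>b\<close> being odd.\<close>
      have "M = {}"
      proof -
        have False if "E \<in> M" for E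
        proof -
          have "card E = h" "card (sym_diff E T) = h"
            using that h by (auto simp: M_def balanced_def k_def)
          then have "2 * card (E \<inter> T) = b"
            using parity[of E] that by (simp add: M_def)
          then show False using \<open>odd b\<close> by presburger
        qed
        then show ?thesis by blast
      qed
      then have cL: "central k \<le> 2 * card L" using split cU by simp
      have "2 ^ card N \<le> (card N + 2) * (central k * central f)"
        unfolding n by (rule central_mult_lower)
      also have "\<dots> \<le> (card N + 2) * (3 * card L * card \<G>)"
        unfolding cG using cL by (intro mult_left_mono mult_right_mono) auto
      finally have "2 ^ card N \<le> 3 * (card N + 2) * (card L * card \<G>)" by (simp add: algebra_simps)
      moreover have "card L * card \<G> \<le> card (separating N T U)"
      proof (rule bound)
        fix E G assume "E \<in> L" "G \<in> \<G>"
        then show "card (sym_diff E T) + card G < (k + f) div 2 \<and>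
          (k + f) div 2 \<le> k - card E + card G \<and> (k + f) div 2 \<le> card E + card G"
          using EL[of E] h by (auto simp: \<G>_def)
      qed (auto simp: \<G>_def)
      ultimately show ?thesis by blast
    next
      case evb: True
      \<comment> \<open>Here parity leaves room for a second size of \<open>G\<close>, which makes
        up for the larger loss to \<open>M\<close>.\<close>
      define \<G> where "\<G> = {G. G \<subseteq> N - U \<and> card G = f div 2} \<union>
        {G. G \<subseteq> N - U \<and> card G = f div 2 + 1}"
      have "card \<G> = (f choose (f div 2)) + (f choose (f div 2 + 1))"
        unfolding \<G>_def subsets[symmetric] using N by (intro card_Un_disjoint) auto
      also have "\<dots> = Suc f choose Suc (f div 2)" by simp
      also have "\<dots> = central (f + 1)"
        using choose_half_up[of "f + 1"] by simp
      finally have cG: "card \<G> = central (f + 1)" .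
      have eva: "even a" using True evb k by simp
      then have "card M \<le> central a * central b"
        using cM fin evb by (simp add: card_balanced a_def b_def)
      moreover have "3 * (central a * central b) \<le> 2 * central k"
        using central_add[of a b] ab k eva by blast
      ultimately have "central k \<le> 6 * card L" using split cU by linarith
      \<comment> \<open>Since \<open>k\<close> is even, halving \<open>central k\<close> turns the
        factor 6 into 3. The unit taken from \<open>k\<close> reappears in
        \<open>central (f + 1)\<close>, so the sum of the arguments is still
        \<open>card N\<close>.\<close>
      moreover have "central k = 2 * central (k - 1)"
        using central_Suc_odd[of "h - 1"] h ab k by (cases h) auto
      ultimately have cL: "central (k - 1) \<le> 3 * card L" by simp
      have nk: "k - 1 + (f + 1) = card N" using n k ab by simp
      have "2 ^ card N \<le> (card N + 2) * (central (k - 1) * central (f + 1))"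
        using central_mult_lower[of "k - 1" "f + 1"] unfolding nk .
      also have "\<dots> \<le> (card N + 2) * (3 * card L * card \<G>)"
        unfolding cG using cL by (intro mult_left_mono mult_right_mono) auto
      finally have "2 ^ card N \<le> 3 * (card N + 2) * (card L * card \<G>)" by (simp add: algebra_simps)
      moreover have "card L * card \<G> \<le> card (separating N T U)"
      proof (rule bound)
        fix E G assume E: "E \<in> L" and G: "G \<in> \<G>"
        \<comment> \<open>The distance within \<open>U\<close> has the parity of \<open>h\<close>
          because \<open>b\<close> is even; being below \<open>h\<close>, it is at most
          \<open>h - 2\<close>.\<close>
        have "card (sym_diff E T) + 2 * card (E \<inter> T) = h + b"
          using parity[of E] E EL(1)[OF E] by (simp add: L_def)
        then have "card (sym_diff E T) + 1 < h"
          using EL(2)[OF E] evb by presburger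
        then show "card (sym_diff E T) + card G < (k + f) div 2 \<and>
          (k + f) div 2 \<le> k - card E + card G \<and> (k + f) div 2 \<le> card E + card G"
          using EL(1)[OF E] h G by (auto simp: \<G>_def)
      qed (auto simp: \<G>_def)
      ultimately show ?thesis by blast
    qed
  qed
  then obtain g where g: "2 ^ card N \<le> 3 * (card N + 2) * (card L * g)"
    "card L * g \<le> card (separating N T U)" by blast
  note g(1)
  also have "3 * (card N + 2) * (card L * g) \<le> 3 * (card N + 2) * card (separating N T U)"
    using g(2) by (rule mult_left_mono) simp
  finally show ?thesis .
qed

text \<open>The hypotheses on \<open>T\<close> say that x differs from z and from y. If
  \<open>T\<close> lies in \<open>U\<close>, then \<open>3 * (n + 2) \<le> 4 * (n + 1)\<close> for
  \<open>n \<ge> 2\<close> gives the common constant; otherwise a coordinate of \<open>T - U\<close>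
  is set aside.\<close>

lemma separating_lower:
  assumes N: "finite N" "card N \<ge> 2" and sub: "T \<subseteq> N" "U \<subseteq> N" and ne: "T \<noteq> {}" "T \<noteq> U"
  shows "2 ^ card N \<le> 4 * (card N + 1) * card (separating N T U)"
proof (cases "T \<subseteq> U")
  case True
  then have "2 ^ card N \<le> 3 * (card N + 2) * card (separating N T U)"
    using assms by (intro separating_lower_inside) auto
  also have "\<dots> \<le> 4 * (card N + 1) * card (separating N T U)"
    using N by (intro mult_right_mono) auto
  finally show ?thesis .
next
  case False
  then obtain i where i: "i \<in> T" "i \<notin> U" by blast
  define m where "m = card N div 2"
  have iN: "i \<in> N" using i sub by blast
  \<comment> \<open>A second coordinate is set aside exactly when \<open>card N\<close> is odd, so
    that an odd number remains.\<close>
  obtain I where I: "I \<subseteq> N" "i \<in> I" and cI: "card (N - I) + 1 = 2 * m"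
    and nI: "card I \<le> 2" "card N = card (N - I) + card I"
  proof (cases "even (card N)")
    case True
    have "card N = card (N - {i}) + 1" using card_Suc_Diff1[OF N(1) iN] by simp
    moreover have "card N = 2 * m" using True by (simp add: m_def)
    ultimately show ?thesis using that[of "{i}"] iN by simp
  next
    case False
    have 1: "card N = card (N - {i}) + 1" using card_Suc_Diff1[OF N(1) iN] by simp
    then have "N - {i} \<noteq> {}" using N(2) by (metis One_nat_def add_0 card.empty not_less_eq_eq numeral_2_eq_2 order.refl)
    then obtain j where j: "j \<in> N - {i}" by blast
    have "card (N - {i}) = card (N - {i} - {j}) + 1"
      using card_Suc_Diff1[OF finite_Diff[OF N(1)] j] by simp
    moreover have ij: "N - {i} - {j} = N - {i, j}" by blast
    ultimately have 2: "card N = card (N - {i, j}) + 2" using 1 unfolding ij by linarith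
    have "card N = 2 * m + 1" using False by (simp add: m_def)
    then have "card (N - {i, j}) + 1 = 2 * m" using 2 by linarith
    moreover have "card {i, j} = 2" using j by auto
    ultimately show ?thesis using that[of "{i, j}"] iN j 2 by auto
  qed
  define p where "p = card (U - I)"
  define q where "q = card (N - I - U)"
  have "p + q = card (N - I)"
  proof -
    have "card ((U - I) \<union> (N - I - U)) = p + q"
      unfolding p_def q_def using N sub by (intro card_Un_disjoint) (auto intro: finite_subset)
    moreover have "(U - I) \<union> (N - I - U) = N - I" using sub by auto
    ultimately show ?thesis by simp
  qed
  \<comment> \<open>Fixing the coordinates in \<open>I\<close> costs \<open>2 ^ card I\<close>,
    whence the 4; as \<open>I\<close> is nonempty, \<open>card N + 1\<close> suffices as the other
    factor.\<close>
  then have pq: "card N = p + q + card I" "p + q + 2 \<le> card N + 1" "2 ^ card I \<le> (4 :: nat)"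
    using nI power_increasing[of "card I" 2 "2 :: nat"] I N
    by (auto simp: Suc_le_eq card_gt_0_iff intro: finite_subset)
  have sep: "central p * central q \<le> card (separating N T U)"
    unfolding p_def q_def using N sub I i cI
    by (intro separating_lower_outside[where i = i]) (auto simp: m_def)
  have "2 ^ card N = (2 ^ card I * 2 ^ (p + q) :: nat)"
    by (simp add: pq(1) power_add)
  also have "\<dots> \<le> 4 * ((p + q + 2) * (central p * central q))"
    using pq(3) by (intro mult_mono central_mult_lower) auto
  also have "\<dots> \<le> 4 * ((card N + 1) * card (separating N T U))"
    using pq(2) sep by (intro mult_left_mono mult_mono) auto
  finally show ?thesis by (simp only: mult.assoc)
qed

section \<open>From sets of coordinates to words\<close>

lemma card_hypercube: "card (hypercube n) = 2 ^ n"
  using card_lists_length_eq[of "UNIV :: bool set" n] by (simp add: hypercube_def)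

lemma finite_hypercube [simp]: "finite (hypercube n)"
  using card_hypercube[of n] by (metis card.infinite power_not_zero zero_neq_numeral)

text \<open>With \<open>Y\<close> a set, the two words to avoid are unordered, which halves the
  number of triples to be served.\<close>

definition words_near_away :: "nat \<Rightarrow> bool list \<Rightarrow> bool list set \<Rightarrow> bool list set" where
  "words_near_away n x Y = {c \<in> hypercube n. hamming_dist x c < n div 2 \<and>
     (\<forall>y\<in>Y. n div 2 \<le> hamming_dist y c)}"

lemma words_near_away_lower:
  assumes "n \<ge> 2" "x \<in> hypercube n" "Y \<subseteq> hypercube n - {x}" "card Y = 2"
  shows "2 ^ n \<le> 4 * (n + 1) * card (words_near_away n x Y)"
proof -
  obtain y z where Y: "Y = {y, z}" using assms(4) card_2_iff by metis
  have len: "length x = n" "length y = n" "length z = n" and neq: "x \<noteq> y" "x \<noteq> z"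
    using assms(2,3) Y by (auto simp: hypercube_def)
  define T where "T = {i. i < n \<and> x ! i \<noteq> z ! i}"
  define U where "U = {i. i < n \<and> y ! i \<noteq> z ! i}"
  \<comment> \<open>\<open>w D\<close> is z with the coordinates in \<open>D\<close> flipped, so
    Hamming distances become sizes of symmetric differences.\<close>
  define w where "w D = map (\<lambda>i. z ! i \<noteq> (i \<in> D)) [0..<n]" for D
  have "T \<noteq> {}"
    using neq(2) len by (auto simp: T_def list_eq_iff_nth_eq)
  moreover have "T \<noteq> U"
  proof
    assume "T = U"
    then have "x ! i = y ! i" if "i < n" for i
      using that unfolding T_def U_def by blast
    then show False using neq(1) len by (simp add: list_eq_iff_nth_eq)
  qed
  ultimately have "2 ^ n \<le> 4 * (n + 1) * card (separating {..<n} T U)"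
    using separating_lower[of "{..<n}" T U] assms(1) by (auto simp: T_def U_def)
  also have "card (separating {..<n} T U) \<le> card (words_near_away n x Y)"
  proof (rule card_inj_on_le[where f = w])
    show "inj_on w (separating {..<n} T U)"
    proof (rule inj_onI)
      fix D E assume "D \<in> separating {..<n} T U" "E \<in> separating {..<n} T U" and eq: "w D = w E"
      then have s: "D \<subseteq> {..<n}" "E \<subseteq> {..<n}" by (auto simp: separating_def)
      have "i \<in> D \<longleftrightarrow> i \<in> E" if "i < n" for i
      proof -
        have "w D ! i = w E ! i" using eq by simp
        then show ?thesis using that by (cases "z ! i") (auto simp: w_def)
      qed
      then show "D = E" using s by blast
    qed
    show "w ` separating {..<n} T U \<subseteq> words_near_away n x Y"
    proof clarify
      fix D assume D: "D \<in> separating {..<n} T U"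
      then have s: "D \<subseteq> {..<n}" by (auto simp: separating_def)
      have "{i. i < length x \<and> x ! i \<noteq> w D ! i} = sym_diff D T"
        "{i. i < length y \<and> y ! i \<noteq> w D ! i} = sym_diff D U"
        "{i. i < length z \<and> z ! i \<noteq> w D ! i} = D"
        using s len by (auto simp: w_def T_def U_def)
      then have "hamming_dist x (w D) = card (sym_diff D T)"
        "hamming_dist y (w D) = card (sym_diff D U)"
        "hamming_dist z (w D) = card D"
        by (simp_all only: hamming_dist_def)
      moreover have "w D \<in> hypercube n" by (simp add: hypercube_def w_def)
      ultimately show "w D \<in> words_near_away n x Y"
        using D by (simp add: words_near_away_def separating_def Y)
    qed
  qed (simp add: words_near_away_def)
  finally show ?thesis by simp
qed

section \<open>Reduction of identification to a hitting problem\<close>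

text \<open>Of two distinct sets one contains a word x missing from the other, and a codeword near x
  and away from the other set tells them apart.\<close>

lemma identifying_code_if_hitting:
  assumes n: "n \<ge> 2" and C: "C \<subseteq> hypercube n"
    and hit: "\<And>x Y. x \<in> hypercube n \<Longrightarrow> Y \<subseteq> hypercube n - {x} \<Longrightarrow> card Y = 2 \<Longrightarrow>
      words_near_away n x Y \<inter> C \<noteq> {}"
  shows "identifying_code n (n div 2 - 1) 2 C"
proof -
  \<comment> \<open>The truncated subtraction is exact since \<open>n div 2 \<ge> 1\<close>.\<close>
  have le: "d \<le> n div 2 - 1 \<longleftrightarrow> d < n div 2" for d :: nat using n by linarith
  have hit': "words_near_away n x Y \<inter> C \<noteq> {}"
    if x: "x \<in> hypercube n" and Y: "Y \<subseteq> hypercube n" "card Y \<le> 2" "x \<notin> Y" for x Y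
  proof -
    \<comment> \<open>There are enough words other than \<open>x\<close> to pad \<open>Y\<close> to
      exactly two.\<close>
    have "(2::nat) ^ 2 \<le> 2 ^ n" using n by (intro power_increasing) auto
    then have "2 \<le> card (hypercube n - {x})"
      using x by (simp add: card_hypercube)
    then obtain Y' where "Y \<subseteq> Y'" "Y' \<subseteq> hypercube n - {x}" "card Y' = 2"
      using exists_subset_between[of Y 2 "hypercube n - {x}"] Y by auto
    then show ?thesis
      using hit[OF x, of Y'] by (fastforce simp: words_near_away_def)
  qed
  have mem: "c \<in> I_set n (n div 2 - 1) C X \<longleftrightarrow> c \<in> C \<and> (\<exists>x\<in>X. hamming_dist x c < n div 2)" for c X
    using C by (auto simp: I_set_def hamming_nbhd_def hamming_ball_def le simp del: One_nat_def)
  have diff: "I_set n (n div 2 - 1) C X \<noteq> I_set n (n div 2 - 1) C Y"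
    if XY: "X \<subseteq> hypercube n" "Y \<subseteq> hypercube n" "card Y \<le> 2" "x \<in> X" "x \<notin> Y" for x X Y
  proof -
    obtain c where "c \<in> words_near_away n x Y" "c \<in> C"
      using hit'[OF subsetD[OF XY(1,4)] XY(2,3,5)] by blast
    then have "c \<in> I_set n (n div 2 - 1) C X" "c \<notin> I_set n (n div 2 - 1) C Y"
      using XY(4) unfolding mem by (auto simp: words_near_away_def)
    then show ?thesis by blast
  qed
  have "replicate n True \<in> hypercube n" by (simp add: hypercube_def)
  then have "C \<noteq> {}" using hit'[of "replicate n True" "{}"] by auto
  moreover have "I_set n (n div 2 - 1) C X \<noteq> I_set n (n div 2 - 1) C Y"
    if "X \<subseteq> hypercube n" "Y \<subseteq> hypercube n" "card X \<le> 2" "card Y \<le> 2" "X \<noteq> Y" for X Y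
  proof -
    consider x where "x \<in> X" "x \<notin> Y" | x where "x \<in> Y" "x \<notin> X" using \<open>X \<noteq> Y\<close> by blast
    then show ?thesis
    proof cases
      case 1
      then show ?thesis by (intro diff[OF that(1,2,4)])
    next
      case 2
      then show ?thesis by (intro diff[OF that(2,1,3), THEN not_sym])
    qed
  qed
  ultimately show ?thesis
    using C by (simp add: identifying_code_def is_code_def)
qed

section \<open>Greedy choice of a hitting set\<close>

text \<open>Averaging: counting the pairs of \<open>c\<close> and \<open>j\<close> with
  \<open>c \<in> G j\<close> in two ways shows that an average \<open>c\<close> hits at least the
  fraction \<open>q\<close> of the sets.\<close>

lemma greedy_hitting_step:
  fixes q :: real
  assumes V: "finite V" "V \<noteq> {}" and J: "finite J"
    and G: "\<And>j. j \<in> J \<Longrightarrow> G j \<subseteq> V \<and> q * card V \<le> card (G j)"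
  shows "\<exists>c\<in>V. q * card J \<le> card {j \<in> J. c \<in> G j}"
proof (rule ccontr)
  assume "\<not> ?thesis"
  then have "(\<Sum>c\<in>V. real (card {j \<in> J. c \<in> G j})) < (\<Sum>c\<in>V. q * card J)"
    using V by (intro sum_strict_mono) (auto simp: not_le)
  also have "\<dots> = (\<Sum>j\<in>J. q * card V)" by simp
  also have "\<dots> \<le> (\<Sum>j\<in>J. real (card (G j)))"
    using G by (intro sum_mono) auto
  also have "\<dots> = (\<Sum>c\<in>V. real (card {j \<in> J. c \<in> G j}))"
  proof -
    have "{c \<in> V. c \<in> G j} = G j" if "j \<in> J" for j using G[OF that] by blast
    then have "(\<Sum>c\<in>V. card {j \<in> J. c \<in> G j}) = (\<Sum>j\<in>J. card (G j))"
      using V J by (intro sum_multicount_gen) auto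
    then show ?thesis by (simp only: of_nat_sum[symmetric])
  qed
  finally show False by simp
qed

text \<open>Applied to the sets still missed, each new element leaves at most the fraction
  \<open>1 - q\<close> of them.\<close>

lemma greedy_hitting:
  fixes q :: real
  assumes V: "finite V" "V \<noteq> {}" and J: "finite J" and q: "q \<le> 1"
    and G: "\<And>j. j \<in> J \<Longrightarrow> G j \<subseteq> V \<and> q * card V \<le> card (G j)"
  shows "\<exists>C\<subseteq>V. card C \<le> K \<and> card {j \<in> J. G j \<inter> C = {}} \<le> card J * (1 - q) ^ K"
proof (induction K)
  case 0
  show ?case by (intro exI[of _ "{}"]) simp
next
  case (Suc K)
  then obtain C where C: "C \<subseteq> V" "card C \<le> K"
    and le: "card {j \<in> J. G j \<inter> C = {}} \<le> card J * (1 - q) ^ K" by blast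
  define R where "R = {j \<in> J. G j \<inter> C = {}}"
  obtain c where c: "c \<in> V" "q * card R \<le> card {j \<in> R. c \<in> G j}"
    using greedy_hitting_step[of V R G q] V J G by (auto simp: R_def)
  have "{j \<in> J. G j \<inter> insert c C = {}} = R - {j \<in> R. c \<in> G j}"
    by (auto simp: R_def)
  moreover have "card (R - {j \<in> R. c \<in> G j}) = card R - card {j \<in> R. c \<in> G j}"
    using J by (intro card_Diff_subset) (auto simp: R_def)
  moreover have "card {j \<in> R. c \<in> G j} \<le> card R"
    using J by (intro card_mono) (auto simp: R_def)
  ultimately have "real (card {j \<in> J. G j \<inter> insert c C = {}}) \<le> (1 - q) * card R"
    using c(2) by (simp add: of_nat_diff algebra_simps)
  also have "\<dots> \<le> (1 - q) * (card J * (1 - q) ^ K)"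
    using le q by (intro mult_left_mono) (auto simp: R_def)
  finally have "card {j \<in> J. G j \<inter> insert c C = {}} \<le> card J * (1 - q) ^ Suc K"
    by (simp add: algebra_simps)
  moreover have "card (insert c C) \<le> Suc K"
    using C(2) card_insert_le_m1[of "Suc K" C c] by simp
  ultimately show ?case using C c by (intro exI[of _ "insert c C"]) auto
qed

text \<open>By \<open>1 - q \<le> exp (- q)\<close> it is enough that
  \<open>ln 2 * (3 * n - 1) < q * K\<close>. With \<open>ln 2 \<le> 25 / 36\<close> this becomes a
  cubic inequality that holds from 10 on and fails at 9.\<close>

lemma hitting_budget:
  fixes n :: nat
  assumes n: "n \<ge> 10"
  shows "2 ^ (3 * n - 1) * (1 - 1 / (4 * (real n + 1))) ^ (n ^ 3 - n ^ 2) < 1"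
proof -
  define q where "q = 1 / (4 * (real n + 1))"
  define K where "K = n ^ 3 - n ^ 2"
  have K: "real K = real n ^ 3 - real n ^ 2"
    unfolding K_def using n by (subst of_nat_diff) (auto intro: power_increasing)
  have q: "0 < q" "q \<le> 1" by (auto simp: q_def divide_simps)
  have poly: "25 * (3 * real n - 1) * (4 * (real n + 1)) < 36 * (real n ^ 3 - real n ^ 2)"
  proof -
    \<comment> \<open>Expanding at 10 leaves only positive coefficients.\<close>
    define t where "t = real n - 10"
    have t: "t \<ge> 0" "real n = t + 10" using n by (auto simp: t_def)
    have "0 < 36 * t ^ 3 + 744 * t ^ 2 + 3880 * t + 500"
      using t(1) by (simp add: add_nonneg_pos)
    also have "\<dots> = 36 * (real n ^ 3 - real n ^ 2) - 25 * (3 * real n - 1) * (4 * (real n + 1))"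
      unfolding t(2) by (simp add: power2_eq_square power3_eq_cube algebra_simps)
    finally show ?thesis by simp
  qed
  have "ln 2 * (3 * real n - 1) \<le> 25 / 36 * (3 * real n - 1)"
    using ln2_le_25_over_36 n by (intro mult_right_mono) auto
  also have "\<dots> < q * K"
    using poly by (simp add: q_def K field_simps)
  finally have lt: "ln 2 * (3 * real n - 1) < q * K" .
  have "(1 - q) ^ K \<le> exp (- q) ^ K"
    using exp_ge_add_one_self[of "- q"] q by (intro power_mono) auto
  also have "\<dots> = exp (- (q * K))" by (simp add: exp_of_nat_mult[symmetric] algebra_simps)
  finally have 1: "(1 - q) ^ K \<le> exp (- (q * K))" .
  have "(2::real) ^ (3 * n - 1) = exp (ln 2 * (3 * real n - 1))"
  proof -
    have "(2::real) ^ (3 * n - 1) = exp (real (3 * n - 1) * ln 2)"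
      by (subst exp_of_nat_mult) simp
    then show ?thesis using n by (simp add: of_nat_diff mult.commute)
  qed
  then have "2 ^ (3 * n - 1) * (1 - q) ^ K \<le> exp (ln 2 * (3 * real n - 1)) * exp (- (q * K))"
    using 1 by (simp add: mult_left_mono)
  also have "\<dots> = exp (ln 2 * (3 * real n - 1) - q * K)" by (simp add: exp_diff exp_minus divide_inverse)
  also have "\<dots> < 1" using lt by simp
  finally show ?thesis by (simp add: q_def K_def)
qed

section \<open>Whole space in small dimensions, greedy code in large ones\<close>

theorem theorem3:
  fixes n r :: nat
  assumes "n \<ge> 2"
    and "r = n div 2 - 1"
  shows "\<exists>C. identifying_code n r 2 C \<and> card C \<le> n ^ 3 - n ^ 2"
proof (cases "n \<le> 9")
  case True
  have "identifying_code n r 2 (hypercube n)"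
    unfolding assms(2)
  proof (rule identifying_code_if_hitting[OF assms(1) order.refl])
    fix x Y assume "x \<in> hypercube n" "Y \<subseteq> hypercube n - {x}" "card Y = 2"
    then have "2 ^ n \<le> 4 * (n + 1) * card (words_near_away n x Y)"
      by (rule words_near_away_lower[OF assms(1)])
    then have "words_near_away n x Y \<noteq> {}" by (cases "words_near_away n x Y = {}") auto
    then show "words_near_away n x Y \<inter> hypercube n \<noteq> {}"
      by (auto simp: words_near_away_def)
  qed
  \<comment> \<open>The size of the whole space meets the bound with equality at 2, where both sides
    are 4, and first exceeds it at 10, where 1024 > 900.\<close>
  moreover have "n \<in> {2, 3, 4, 5, 6, 7, 8, 9}" using True assms(1) by auto
  then have "card (hypercube n) \<le> n ^ 3 - n ^ 2" by (auto simp: card_hypercube)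
  ultimately show ?thesis by blast
next
  case False
  define K where "K = n ^ 3 - n ^ 2"
  define q where "q = 1 / (4 * (real n + 1))"
  define H where "H = hypercube n"
  define J where "J = (SIGMA x:H. {Y. Y \<subseteq> H - {x} \<and> card Y = 2})"
  have fin: "finite H" and cH: "card H = 2 ^ n" by (simp_all add: H_def card_hypercube)
  have Hne: "H \<noteq> {}" using cH by auto
  have finJ: "finite J" unfolding J_def using fin by (intro finite_SigmaI) auto
  have cJ: "real (card J) \<le> 2 ^ (3 * n - 1)"
  proof -
    have "card {Y. Y \<subseteq> H - {x} \<and> card Y = 2} = (2 ^ n - 1) choose 2" if "x \<in> H" for x
      using n_subsets[of "H - {x}" 2] fin that cH by simp
    then have "card J = (\<Sum>x\<in>H. (2 ^ n - 1) choose 2)"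
      unfolding J_def using fin by (subst card_SigmaI) auto
    also have "\<dots> = 2 ^ n * ((2 ^ n - 1) choose 2)" by (simp add: cH)
    \<comment> \<open>The half from counting unordered pairs becomes the \<open>- 1\<close> in the
      exponent.\<close>
    finally have "2 * card J \<le> 2 ^ n * ((2 ^ n - 1) * (2 ^ n - 1 - 1))"
      by (simp add: choose_two)
    also have "\<dots> \<le> 2 ^ n * (2 ^ n * 2 ^ n)" by (intro mult_mono) auto
    also have "\<dots> = 2 ^ (3 * n)" by (simp add: power_add[symmetric])
    also have "\<dots> = 2 * 2 ^ (3 * n - 1)"
      using False by (simp add: power_Suc[symmetric] del: power_Suc)
    finally have "card J \<le> 2 ^ (3 * n - 1)" by simp
    then show ?thesis by (metis of_nat_le_iff of_nat_numeral of_nat_power)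
  qed
  have "\<exists>C\<subseteq>H. card C \<le> K \<and>
    card {j \<in> J. words_near_away n (fst j) (snd j) \<inter> C = {}} \<le> card J * (1 - q) ^ K"
  proof (rule greedy_hitting[OF fin Hne finJ])
    fix j assume "j \<in> J"
    then have "2 ^ n \<le> 4 * (n + 1) * card (words_near_away n (fst j) (snd j))"
      using assms(1) by (intro words_near_away_lower) (auto simp: J_def H_def)
    then have "real (2 ^ n) \<le> real (4 * (n + 1) * card (words_near_away n (fst j) (snd j)))"
      by (simp only: of_nat_le_iff)
    then have "q * card H \<le> card (words_near_away n (fst j) (snd j))"
      by (simp add: q_def cH field_simps)
    then show "words_near_away n (fst j) (snd j) \<subseteq> H \<and>
      q * card H \<le> card (words_near_away n (fst j) (snd j))"
      by (auto simp: words_near_away_def H_def)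
  qed (simp add: q_def divide_simps)
  then obtain C where C: "C \<subseteq> H" "card C \<le> K" and
    le: "card {j \<in> J. words_near_away n (fst j) (snd j) \<inter> C = {}} \<le> card J * (1 - q) ^ K"
    by blast
  have "card J * (1 - q) ^ K \<le> 2 ^ (3 * n - 1) * (1 - q) ^ K"
    using cJ by (intro mult_right_mono) (auto simp: q_def divide_simps)
  also have "\<dots> < 1" unfolding q_def K_def using False by (intro hitting_budget) simp
  \<comment> \<open>A natural number below 1 vanishes: no pair in \<open>J\<close> is left
    unserved.\<close>
  finally have "card {j \<in> J. words_near_away n (fst j) (snd j) \<inter> C = {}} = 0"
    using le by linarith
  then have all: "{j \<in> J. words_near_away n (fst j) (snd j) \<inter> C = {}} = {}"
    using finJ by simp
  have "identifying_code n r 2 C"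
    unfolding assms(2)
  proof (rule identifying_code_if_hitting[OF assms(1)])
    fix x Y assume "x \<in> hypercube n" "Y \<subseteq> hypercube n - {x}" "card Y = 2"
    then have "(x, Y) \<in> J" by (simp add: J_def H_def)
    then show "words_near_away n x Y \<inter> C \<noteq> {}" using all by auto
  qed (use C in \<open>simp add: H_def\<close>)
  then show ?thesis using C(2) by (auto simp: K_def)
qed

end
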